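(* For all time series $S$ and $T$ over $\mathbb R^k$, $d^\Delta_m(S,T)\le 2\cdot d^C_1(S,T)$.
   Context: A time series over $\mathbb R^k$ is a finite sequence $T=(t_0,\dots,t_{n-1})$ of vectors in $\mathbb R^k$, with length $\#T=n$; $T_b^\ell=(t_b,\dots,t_{b+\ell-1})$ is its subseries. For equal-length $S,T$, $d_1(S,T)=\sum_i\|s_i-t_i\|_2$; if $\#S=m\le n=\#T$, $d_1(S,T)=d_1(T,S)=\min_{b\in[0,n-m]}d_1(S,T_b^m)$. The congruence distance is $d_1^C(S,T)=\inf_{M,v}d_1(S,M\cdot T+v)$ over real orthogonal $k\times k$ matrices $M$ and $v\in\mathbb R^k$, where $M\cdot T+v=(Mt_i+v)_i$. The structure of $T$ is $\Delta T=(\|t_i-t_{i+j}\|_2)_{i\in[0,n-1),j\in[1,n-i)}$. For equal-length $S,T$, $d^\Delta_m(S,T)=\max_{j}\sum_{i}|(\Delta S)_{i,j}-(\Delta T)_{i,j}|$ (max column norm, columns indexed by the offset $j$); for $\#S=m\le n=\#T$, $d^\Delta_m(S,T)=d^\Delta_m(T,S)=\min_{b\in[0,n-m]}d^\Delta_m(S,T_b^m)$. *)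

theory Defs
  imports "HOL-Analysis.Analysis"
begin

type_synonym 'k time_series = "(real ^ 'k) list"

definition subseries :: "'k::finite time_series \<Rightarrow> nat \<Rightarrow> nat \<Rightarrow> 'k time_series" where
  "subseries T b l = take l (drop b T)"

(* Extension of a distance on equal-length series to arbitrary lengths: the minimum over all
   placements of the shorter series inside the longer one. *)
definition min_align ::
    "('k::finite time_series \<Rightarrow> 'k time_series \<Rightarrow> real) \<Rightarrow> 'k time_series \<Rightarrow> 'k time_series \<Rightarrow> real" where
  "min_align d S T =
     (if length S \<le> length T
      then Min ((\<lambda>b. d S (subseries T b (length S))) ` {0..length T - length S})
      else Min ((\<lambda>b. d T (subseries S b (length T))) ` {0..length S - length T}))"

lemma min_align_eq_length:
  "length S = length T \<Longrightarrow> min_align d S T = d S T"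
  by (simp add: min_align_def subseries_def)

definition d1_eq :: "'k::finite time_series \<Rightarrow> 'k time_series \<Rightarrow> real" where
  "d1_eq S T = (\<Sum>i<length S. norm (S ! i - T ! i))"

definition d1 :: "'k::finite time_series \<Rightarrow> 'k time_series \<Rightarrow> real" where
  "d1 = min_align d1_eq"

definition transform :: "real ^ 'k ^ 'k \<Rightarrow> real ^ 'k \<Rightarrow> 'k::finite time_series \<Rightarrow> 'k time_series" where
  "transform M v T = map (\<lambda>t. M *v t + v) T"

definition d1_congruence :: "'k::finite time_series \<Rightarrow> 'k time_series \<Rightarrow> real" where
  "d1_congruence S T = (INF (M, v) \<in> {M. orthogonal_matrix M} \<times> UNIV. d1 S (transform M v T))"

(* Entry (i, j) of the structure; only meaningful for 1 \<le> j and i + j < length T. *)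
definition structure_entry :: "'k::finite time_series \<Rightarrow> nat \<Rightarrow> nat \<Rightarrow> real" where
  "structure_entry T i j = norm (T ! i - T ! (i + j))"

(* A series with fewer than two elements has an empty structure, whose norm is 0. *)
definition d_delta_eq :: "'k::finite time_series \<Rightarrow> 'k time_series \<Rightarrow> real" where
  "d_delta_eq S T =
     (if length S < 2 then 0
      else Max ((\<lambda>j. \<Sum>i<length S - j. \<bar>structure_entry S i j - structure_entry T i j\<bar>)
                ` {1..<length S}))"

definition d_delta :: "'k::finite time_series \<Rightarrow> 'k time_series \<Rightarrow> real" where
  "d_delta = min_align d_delta_eq"

end

theory Submission
  imports Defs
begin

text \<open>The structure of a series is invariant under isometries, so it suffices to bound the
  structure distance by twice \<open>d1\<close>. For equal lengths, the triangle inequality bounds each summand of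
  column \<open>j\<close> by \<open>\<parallel>s\<^sub>i - t\<^sub>i\<parallel> + \<parallel>s\<^sub>i\<^sub>+\<^sub>j - t\<^sub>i\<^sub>+\<^sub>j\<parallel>\<close>, and both parts sum to at most
  the \<open>d1\<close> distance; the bound then passes to the minimum over all placements.\<close>

text \<open>Evaluate the left-hand minimum at a placement that attains the right-hand one.\<close>

lemma min_align_le_mult:
  assumes "\<And>A B. d A B \<le> c * d' A B"
  shows "min_align d S T \<le> c * min_align d' S T"
proof -
  have *: "Min (f ` {0..n}) \<le> c * Min (g ` {0..n})"
    if "\<And>b. f b \<le> c * g b" for f g :: "nat \<Rightarrow> real" and n
  proof -
    have "Min (g ` {0..n}) \<in> g ` {0..n}"
      by (intro Min_in) auto
    then obtain b where b: "b \<in> {0..n}" "Min (g ` {0..n}) = g b"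
      by blast
    have "Min (f ` {0..n}) \<le> f b"
      using b(1) by (intro Min_le) auto
    with that[of b] b(2) show ?thesis
      by simp
  qed
  show ?thesis
    unfolding min_align_def using assms by (simp add: *)
qed

lemma d1_eq_nonneg: "0 \<le> d1_eq S T"
  by (simp add: d1_eq_def sum_nonneg)

text \<open>Both sides index by \<open>length S\<close> alone, and the entrywise bound holds
  whatever value \<open>T ! i\<close> takes, so lengths may differ here, as
  \<open>min_align_le_mult\<close> requires.\<close>

lemma d_delta_eq_le_d1_eq: "d_delta_eq S T \<le> 2 * d1_eq S T"
proof (cases "length S < 2")
  case True
  then show ?thesis
    by (simp add: d_delta_eq_def d1_eq_nonneg)
next
  case False
  have column: "(\<Sum>i<length S - j. \<bar>structure_entry S i j - structure_entry T i j\<bar>) \<le> 2 * d1_eq S T"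
    if j: "j < length S" for j
  proof -
    let ?e = "\<lambda>i. norm (S ! i - T ! i)"
    have entry: "\<bar>structure_entry S i j - structure_entry T i j\<bar> \<le> ?e i + ?e (i + j)" for i
      unfolding structure_entry_def by norm
    have "(\<Sum>i<length S - j. \<bar>structure_entry S i j - structure_entry T i j\<bar>)
        \<le> (\<Sum>i<length S - j. ?e i) + (\<Sum>i<length S - j. ?e (i + j))"
      unfolding sum.distrib[symmetric] by (intro sum_mono entry)
    moreover have "(\<Sum>i<length S - j. ?e i) \<le> d1_eq S T"
      unfolding d1_eq_def by (intro sum_mono2) auto
    moreover have "(\<Sum>i<length S - j. ?e (i + j)) \<le> d1_eq S T"
    proof -
      \<comment> \<open>The shift by \<open>j\<close> is injective and stays below
        \<open>length S\<close>, so this is a partial sum of \<open>d1_eq S T\<close>.\<close>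
      have "(\<Sum>i<length S - j. ?e (i + j)) = sum ?e ((\<lambda>i. i + j) ` {..<length S - j})"
        by (subst sum.reindex) auto
      also have "\<dots> \<le> d1_eq S T"
        unfolding d1_eq_def by (intro sum_mono2) auto
      finally show ?thesis .
    qed
    ultimately show ?thesis
      by linarith
  qed
  have "{1..<length S} \<noteq> {}"
    using False by simp
  then show ?thesis
    using False column by (simp add: d_delta_eq_def)
qed

lemma d_delta_le_d1: "d_delta S T \<le> 2 * d1 S T"
  unfolding d_delta_def d1_def by (intro min_align_le_mult d_delta_eq_le_d1_eq)

lemma length_transform [simp]: "length (transform M v T) = length T"
  by (simp add: transform_def)

lemma subseries_transform: "subseries (transform M v T) b l = transform M v (subseries T b l)"
  by (simp add: subseries_def transform_def take_map drop_map)

text \<open>The translation \<open>v\<close> cancels in differences, and \<open>M\<close> preserves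
  norms.\<close>

lemma structure_entry_transform:
  assumes "orthogonal_matrix M" "i + j < length T"
  shows "structure_entry (transform M v T) i j = structure_entry T i j"
proof -
  have "norm (M *v x) = norm x" for x
    using assms(1) orthogonal_transformation_matrix[of "(*v) M"]
    by (simp add: orthogonal_transformation_norm)
  with assms(2) show ?thesis
    by (simp add: structure_entry_def transform_def flip: matrix_vector_mult_diff_distrib)
qed

lemma d_delta_eq_transform_left:
  assumes "orthogonal_matrix M"
  shows "d_delta_eq (transform M v S) T = d_delta_eq S T"
  using assms by (simp add: d_delta_eq_def structure_entry_transform)

text \<open>Indices run up to \<open>length S\<close>; the length assumption keeps them inside
  \<open>T\<close>.\<close>

lemma d_delta_eq_transform_right:
  assumes "orthogonal_matrix M" "length S \<le> length T"
  shows "d_delta_eq S (transform M v T) = d_delta_eq S T"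
  using assms by (simp add: d_delta_eq_def structure_entry_transform)

text \<open>The transformed series is the second argument of \<open>d_delta_eq\<close> when
  \<open>S\<close> is no longer than \<open>T\<close>, and the first otherwise.\<close>

lemma d_delta_transform:
  assumes "orthogonal_matrix M"
  shows "d_delta S (transform M v T) = d_delta S T"
proof -
  have "d_delta_eq S (transform M v (subseries T b (length S))) = d_delta_eq S (subseries T b (length S))"
    if "b \<in> {0..length T - length S}" "length S \<le> length T" for b
    using assms that by (intro d_delta_eq_transform_right) (auto simp: subseries_def)
  with assms show ?thesis
    by (auto simp: d_delta_def min_align_def subseries_transform d_delta_eq_transform_left
        intro!: arg_cong[where f = Min] image_cong)
qed

theorem theorem4:
  fixes S T :: "'k::finite time_series"
  shows "d_delta S T \<le> 2 * d1_congruence S T"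
proof -
  \<comment> \<open>Dividing by 2 leaves a bare infimum on the right, to be bounded below for each
    pair \<open>(M, v)\<close>.\<close>
  have "d_delta S T / 2 \<le> d1_congruence S T"
    unfolding d1_congruence_def
  proof (rule cINF_greatest)
    show "{M :: real ^ 'k ^ 'k. orthogonal_matrix M} \<times> (UNIV :: (real ^ 'k) set) \<noteq> {}"
      using orthogonal_matrix_id by blast
  next
    fix p :: "(real ^ 'k ^ 'k) \<times> (real ^ 'k)"
    assume "p \<in> {M. orthogonal_matrix M} \<times> UNIV"
    then obtain M v where p: "p = (M, v)" and M: "orthogonal_matrix M"
      by auto
    show "d_delta S T / 2 \<le> (case p of (M, v) \<Rightarrow> d1 S (transform M v T))"
      using d_delta_le_d1[of S "transform M v T"] d_delta_transform[OF M, of S v T] p by simp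
  qed
  then show ?thesis
    by simp
qed

end
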